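(* The set of all real Wiener roots of connected graphs is dense in $(-\infty, 0]$. In fact, the set of real Wiener roots of connected graphs of diameter $2$ is already dense in $(-\infty,0]$.
   Context: For a connected graph $G$ of order at least $2$, the Wiener polynomial is $W(G;x)=\sum x^{d(u,v)}$, where $d(u,v)$ is the distance between $u$ and $v$ and the sum ranges over all unordered pairs of distinct vertices. A Wiener root of $G$ is a complex root of $W(G;x)$. *)

theory Defs
  imports
    "HOL-Analysis.Analysis"
    "HOL-Computational_Algebra.Polynomial"
    "Graph_Theory.Digraph_Component"
begin

text \<open>
  Finite simple undirected graphs are the library's \<^locale>\<open>pair_graph\<close>: finite vertex set,
  arcs a symmetric irreflexive relation on it. The constant \<open>Digraph_Component.connected\<close> is
  qualified because topological connectedness has the same base name.
\<close>

definition connected_graph :: "'a pair_pre_digraph \<Rightarrow> bool" where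
  "connected_graph G \<longleftrightarrow> pair_graph G \<and> Digraph_Component.connected (with_proj G)"

text \<open>Only meaningful when \<open>v\<close> can be reached from \<open>u\<close>, as always in a connected graph.\<close>

definition gdist :: "'a pair_pre_digraph \<Rightarrow> 'a \<Rightarrow> 'a \<Rightarrow> nat" where
  "gdist G u v = (LEAST n. \<exists>p. pre_digraph.awalk (with_proj G) u p v \<and> length p = n)"

definition gdiameter :: "'a pair_pre_digraph \<Rightarrow> nat" where
  "gdiameter G = Max {gdist G u v | u v. u \<in> pverts G \<and> v \<in> pverts G}"

text \<open>
  Each unordered pair of distinct vertices is represented once, by the ordered pair whose first
  component is the smaller vertex. As the distance is symmetric, the choice of the order is
  immaterial.
\<close>

definition wiener_poly :: "'a::linorder pair_pre_digraph \<Rightarrow> complex poly" where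
  "wiener_poly G =
     (\<Sum>(u, v) \<in> {(u, v). u \<in> pverts G \<and> v \<in> pverts G \<and> u < v}. monom 1 (gdist G u v))"

definition wiener_root :: "'a::linorder pair_pre_digraph \<Rightarrow> complex \<Rightarrow> bool" where
  "wiener_root G z \<longleftrightarrow> poly (wiener_poly G) z = 0"

text \<open>
  Vertices are natural numbers: every finite graph is isomorphic to one of this form, and
  isomorphic graphs have the same Wiener polynomial.
\<close>

definition real_wiener_roots :: "real set" where
  "real_wiener_roots =
     {x. \<exists>G :: nat pair_pre_digraph.
           connected_graph G \<and> card (pverts G) \<ge> 2 \<and> wiener_root G (complex_of_real x)}"

definition real_wiener_roots_diam2 :: "real set" where
  "real_wiener_roots_diam2 =
     {x. \<exists>G :: nat pair_pre_digraph.
           connected_graph G \<and> card (pverts G) \<ge> 2 \<and> gdiameter G = 2 \<and>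
           wiener_root G (complex_of_real x)}"

definition dense_in :: "'a::topological_space set \<Rightarrow> 'a set \<Rightarrow> bool" where
  "dense_in A X \<longleftrightarrow> A \<subseteq> X \<and> X \<subseteq> closure A"

end

theory Submission
  imports Defs
begin

text \<open>
  A graph of diameter 2 with \<open>N\<close> pairs of vertices and \<open>m\<close> edges has the Wiener polynomial
  \<open>m x + (N - m) x\<^sup>2\<close> and hence the root \<open>- m / (N - m)\<close>. Any \<open>m\<close> with \<open>n - 1 \<le> m < N\<close> occurs
  for a graph on \<open>n\<close> vertices: add edges to a star. With \<open>n = 2 (a + b)\<close> and \<open>m = a (n - 1)\<close> one
  gets \<open>N = (a + b) (n - 1)\<close>, so that every negative rational \<open>- a / b\<close> is a root.
\<close>

lemma gdist_same:
  assumes "u \<in> pverts G"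
  shows "gdist G u u = 0"
  unfolding gdist_def
  by (rule Least_equality)
     (auto intro!: exI[of _ "[]"] simp: pre_digraph.awalk_def pre_digraph.cas.simps assms)

lemma gdist_adjacent:
  assumes "u \<in> pverts G" "(u, v) \<in> parcs G" "u \<noteq> v"
  shows "gdist G u v = 1"
  unfolding gdist_def
proof (rule Least_equality)
  show "\<exists>p. pre_digraph.awalk (with_proj G) u p v \<and> length p = 1"
    using assms by (auto intro!: exI[of _ "[(u, v)]"]
        simp: pre_digraph.awalk_def cas_with_proj_eq)
next
  fix k assume "\<exists>p. pre_digraph.awalk (with_proj G) u p v \<and> length p = k"
  then show "1 \<le> k"
    using assms by (cases k) (auto simp: pre_digraph.awalk_def cas_with_proj_eq)
qed

text \<open>The path through \<open>w\<close> gives length 2. A shorter walk would be empty, forcing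
  \<open>u = v\<close>, or a single arc from \<open>u\<close> to \<open>v\<close>.\<close>

lemma gdist_common_neighbour:
  assumes "u \<in> pverts G" "(u, w) \<in> parcs G" "(w, v) \<in> parcs G"
    and "(u, v) \<notin> parcs G" "u \<noteq> v"
  shows "gdist G u v = 2"
  unfolding gdist_def
proof (rule Least_equality)
  show "\<exists>p. pre_digraph.awalk (with_proj G) u p v \<and> length p = 2"
    using assms by (auto intro!: exI[of _ "[(u, w), (w, v)]"]
        simp: pre_digraph.awalk_def cas_with_proj_eq)
next
  fix k assume "\<exists>p. pre_digraph.awalk (with_proj G) u p v \<and> length p = k"
  then obtain p where p: "set p \<subseteq> parcs G" "pcas u p v" "length p = k"
    by (auto simp: pre_digraph.awalk_def cas_with_proj_eq)
  show "2 \<le> k"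
  proof (rule ccontr)
    assume "\<not> 2 \<le> k"
    then consider "p = []" | e where "p = [e]"
      using p(3) by (cases p; cases "tl p") auto
    then show False
      using p assms by cases auto
  qed
qed

text \<open>Keeping one orientation per edge in \<open>E\<close> makes \<open>card E\<close> the
  number of edges; the converse supplies the symmetry of the arc relation.\<close>

definition graph_of_edges :: "nat \<Rightarrow> (nat \<times> nat) set \<Rightarrow> nat pair_pre_digraph" where
  "graph_of_edges n E = \<lparr>pverts = {..<n}, parcs = E \<union> E\<inverse>\<rparr>"

lemma graph_of_edges_simps [simp]:
  "pverts (graph_of_edges n E) = {..<n}"
  "parcs (graph_of_edges n E) = E \<union> E\<inverse>"
  by (simp_all add: graph_of_edges_def)

abbreviation vertex_pairs :: "nat \<Rightarrow> (nat \<times> nat) set" where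
  "vertex_pairs n \<equiv> {(u, v). u < v \<and> v < n}"

lemma vertex_pairs_eq_Sigma: "vertex_pairs n = prod.swap ` (SIGMA v:{..<n}. {..<v})"
  by (auto simp: image_iff)

lemma finite_vertex_pairs: "finite (vertex_pairs n)"
  by (simp add: vertex_pairs_eq_Sigma)

text \<open>Doubling avoids division on natural numbers. Grouping the pairs by their larger vertex
  \<open>v\<close> leaves a sum of \<open>v\<close> over \<open>v < n\<close>.\<close>

lemma card_vertex_pairs: "2 * card (vertex_pairs n) = n * (n - 1)"
proof -
  have "card (vertex_pairs n) = (\<Sum>v<n. v)"
    by (simp add: vertex_pairs_eq_Sigma card_image)
  also have "2 * \<dots> = n * (n - 1)"
  proof (induction n)
    case (Suc n)
    then show ?case
      by (cases n) (simp_all add: algebra_simps)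
  qed simp
  finally show ?thesis .
qed

text \<open>Vertex 0 is the centre of a spanning star, so all distances are at most 2 and depend
  only on adjacency.\<close>

locale star_supergraph =
  fixes n :: nat and E :: "(nat \<times> nat) set"
  assumes two_vertices: "2 \<le> n"
    and edges: "E \<subseteq> vertex_pairs n"
    and star: "\<And>v. 0 < v \<Longrightarrow> v < n \<Longrightarrow> (0, v) \<in> E"
begin

abbreviation G :: "nat pair_pre_digraph" where
  "G \<equiv> graph_of_edges n E"

lemma connected_graph: "connected_graph G"
proof -
  have "finite E"
    using edges finite_vertex_pairs finite_subset by blast
  then interpret pair_graph G
    using edges
    by unfold_locales (auto simp: symmetric_def sym_def)
  have reach_0: "v \<rightarrow>\<^sup>*\<^bsub>G\<^esub> 0" "0 \<rightarrow>\<^sup>*\<^bsub>G\<^esub> v" if "v < n" for v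
  proof -
    have "v = 0 \<or> (v, 0) \<in> parcs G \<and> (0, v) \<in> parcs G"
      using star[of v] that by auto
    moreover have "0 \<in> pverts G"
      using two_vertices by auto
    ultimately show "v \<rightarrow>\<^sup>*\<^bsub>G\<^esub> 0" "0 \<rightarrow>\<^sup>*\<^bsub>G\<^esub> v"
      by (auto intro: reachable_adjI)
  qed
  have "connected (with_proj G)"
  proof (rule connectedI)
    have "0 \<in> pverts G"
      using two_vertices by simp
    then show "pverts G \<noteq> {}"
      by blast
  next
    fix u v assume "u \<in> pverts G" "v \<in> pverts G"
    then have "u \<rightarrow>\<^sup>*\<^bsub>G\<^esub> v"
      by (auto intro: reachable_trans[OF reach_0])
    \<comment> \<open>Connectedness is reachability in the symmetric closure, which inherits it from
      \<open>G\<close>.\<close>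
    then show "u \<rightarrow>\<^sup>*\<^bsub>mk_symmetric G\<^esub> v"
      by (rule reachable_mk_symmetricI)
  qed
  then show ?thesis
    by (auto simp: connected_graph_def)
qed

lemma gdist:
  assumes "u < n" "v < n"
  shows "gdist G u v = (if u = v then 0 else if (u, v) \<in> E \<union> E\<inverse> then 1 else 2)"
proof -
  have "gdist G u v = 2" if "u \<noteq> v" "(u, v) \<notin> E \<union> E\<inverse>"
  proof (rule gdist_common_neighbour[where w = 0])
    \<comment> \<open>The centre is adjacent to every other vertex, so neither end of a non-adjacent
      pair is the centre.\<close>
    have "0 < u" "0 < v"
      using that star[of u] star[of v] assms by (auto intro: Nat.gr0I)
    then show "(u, 0) \<in> parcs G" "(0, v) \<in> parcs G"
      using star assms by auto
  qed (use that assms in auto)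
  moreover have "gdist G u v = 1" if "u \<noteq> v" "(u, v) \<in> E \<union> E\<inverse>"
    by (rule gdist_adjacent) (use that assms in auto)
  ultimately show ?thesis
    using assms by (auto simp: gdist_same)
qed

text \<open>A pair missing from \<open>E\<close> attains the bound 2; the assumption excludes the
  complete graph, whose diameter is 1.\<close>

lemma gdiameter:
  assumes "E \<noteq> vertex_pairs n"
  shows "gdiameter G = 2"
proof -
  let ?D = "{gdist G u v | u v. u \<in> pverts G \<and> v \<in> pverts G}"
  have D: "?D \<subseteq> {0, 1, 2}"
    by (auto simp: gdist split: if_splits)
  obtain u v where "u < v" "v < n" "(u, v) \<notin> E"
    using assms edges by auto
  moreover from this have "(v, u) \<notin> E"
    using edges by auto
  ultimately have "gdist G u v = 2" "u \<in> pverts G" "v \<in> pverts G"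
    by (auto simp: gdist)
  then have "2 \<in> ?D"
    by force
  moreover have "finite ?D" "\<forall>d\<in>?D. d \<le> 2"
    using D finite_subset[OF D] by fastforce+
  ultimately show ?thesis
    unfolding gdiameter_def by (intro Max_eqI) auto
qed

text \<open>Each edge contributes \<open>z\<close> and each other pair \<open>z\<^sup>2\<close>. The
  natural subtraction is exact because \<open>E\<close> lies in
  \<open>vertex_pairs n\<close>.\<close>

lemma poly_wiener_poly:
  "poly (wiener_poly G) z
     = of_nat (card E) * z + of_nat (card (vertex_pairs n) - card E) * z\<^sup>2"
proof -
  let ?P = "vertex_pairs n"
  have pairs: "{(u, v). u \<in> pverts G \<and> v \<in> pverts G \<and> u < v} = ?P"
    by auto
  have fin: "finite E"
    using edges finite_vertex_pairs finite_subset by blast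
  \<comment> \<open>For an increasing pair, membership in \<open>E\<inverse>\<close> is impossible,
    so testing \<open>E\<close> alone decides the distance.\<close>
  have "wiener_poly G = (\<Sum>e\<in>?P. monom 1 (if e \<in> E then 1 else 2))"
    unfolding wiener_poly_def pairs
    using edges by (intro sum.cong refl) (auto simp: gdist)
  then have "poly (wiener_poly G) z = (\<Sum>e\<in>?P. if e \<in> E then z else z\<^sup>2)"
    by (auto simp: poly_sum poly_monom intro!: sum.cong)
  also have "\<dots> = (\<Sum>e\<in>E. z) + (\<Sum>e\<in>?P - E. z\<^sup>2)"
    using edges finite_vertex_pairs
    by (subst sum.If_cases) (simp_all add: Int_absorb1 Diff_eq)
  finally show ?thesis
    using edges fin by (simp add: card_Diff_subset)
qed

end

lemma negative_rational_is_wiener_root: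
  assumes "0 < a" "0 < b"
  shows "- (of_nat a / of_nat b) \<in> real_wiener_roots_diam2"
proof -
  define n where "n = 2 * (a + b)"
  let ?P = "vertex_pairs n" and ?S = "Pair (0::nat) ` {1..<n}"
  have n: "2 \<le> n"
    using assms by (simp add: n_def)
  have card_P: "card ?P = a * (n - 1) + b * (n - 1)"
  proof -
    have "2 * card ?P = 2 * ((a + b) * (n - 1))"
      unfolding card_vertex_pairs by (simp add: n_def)
    then show ?thesis
      by (simp add: distrib_right)
  qed
  have "card ?S = n - 1"
    by (simp add: card_image inj_on_def)
  moreover have "n - 1 \<le> a * (n - 1)"
    using assms by simp
  moreover have "?S \<subseteq> ?P"
    by auto
  moreover have "a * (n - 1) \<le> card ?P"
    by (simp add: card_P)
  \<comment> \<open>The prescribed size lies between that of the star and that of the complete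
    graph, so the star can be enlarged to exactly this size.\<close>
  ultimately have "\<exists>E. ?S \<subseteq> E \<and> E \<subseteq> ?P \<and> card E = a * (n - 1)"
    by (intro exists_subset_between finite_vertex_pairs) (simp_all only:)
  then obtain E where E: "?S \<subseteq> E" "E \<subseteq> ?P" "card E = a * (n - 1)"
    by blast
  interpret star_supergraph n E
    using n E by unfold_locales auto
  have co: "card ?P - card E = b * (n - 1)"
    using card_P E by simp
  \<comment> \<open>Since \<open>b\<close> and \<open>n - 1\<close> are positive, some pair is not
    an edge.\<close>
  then have "E \<noteq> ?P"
    using n assms by auto
  \<comment> \<open>The polynomial is now \<open>(n - 1) * (a * z + b * z\<^sup>2)\<close>.\<close>
  moreover have "wiener_root G (complex_of_real (- (of_nat a / of_nat b)))"
    unfolding wiener_root_def poly_wiener_poly co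
    unfolding E(3)
    using assms by (simp add: field_simps power2_eq_square)
  ultimately show ?thesis
    using connected_graph gdiameter n
    by (auto simp: real_wiener_roots_diam2_def intro!: exI[of _ G])
qed

text \<open>At a positive \<open>x\<close> every summand is positive, and order at least 2 provides
  at least one summand.\<close>

lemma real_wiener_roots_nonpos: "real_wiener_roots \<subseteq> {..0}"
proof
  fix x assume "x \<in> real_wiener_roots"
  then obtain G :: "nat pair_pre_digraph" where G: "connected_graph G" "2 \<le> card (pverts G)"
      "wiener_root G (complex_of_real x)"
    by (auto simp: real_wiener_roots_def)
  let ?P = "{(u, v). u \<in> pverts G \<and> v \<in> pverts G \<and> u < v}"
  \<comment> \<open>Infinite sets have cardinality 0, so the bound on the order already gives
    finiteness.\<close>
  have fin: "finite (pverts G)"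
    using G(2) card.infinite by fastforce
  have "finite ?P"
    by (rule finite_subset[OF _ finite_cartesian_product[OF fin fin]]) auto
  moreover have "?P \<noteq> {}"
  proof -
    obtain u v where "u \<in> pverts G" "v \<in> pverts G" "u \<noteq> v"
      using G(2) fin by (auto simp: numeral_2_eq_2 card_le_Suc_iff)
    then show ?thesis
      by (cases u v rule: linorder_cases) auto
  qed
  \<comment> \<open>Rewriting the value as an embedded real sum makes the order on the reals
    available.\<close>
  moreover have "poly (wiener_poly G) (complex_of_real x)
      = complex_of_real (\<Sum>(u, v)\<in>?P. x ^ gdist G u v)"
    by (simp add: wiener_poly_def poly_sum poly_monom case_prod_unfold)
  then have "(\<Sum>(u, v)\<in>?P. x ^ gdist G u v) = 0"
    using G(3) by (simp only: wiener_root_def of_real_eq_0_iff)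
  ultimately have "\<not> 0 < x"
    using sum_pos[of ?P "\<lambda>(u, v). x ^ gdist G u v"] by fastforce
  then show "x \<in> {..0}"
    by simp
qed

lemma nonpos_subset_closure: "{..0} \<subseteq> closure real_wiener_roots_diam2"
proof
  fix y :: real assume y: "y \<in> {..0}"
  show "y \<in> closure real_wiener_roots_diam2"
    unfolding closure_approachable
  proof (intro allI impI)
    fix e :: real assume "0 < e"
    \<comment> \<open>Approximating strictly from below keeps \<open>q\<close> negative even for
      \<open>y = 0\<close>.\<close>
    then obtain q where q: "q \<in> \<rat>" "y - e < q" "q < y"
      using Rats_dense_in_real[of "y - e" y] by auto
    obtain a b :: nat where ab: "b \<noteq> 0" "\<bar>q\<bar> = of_nat a / of_nat b"
      using Rats_abs_nat_div_natE[OF q(1)] by metis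
    have "q < 0"
      using q y by simp
    then have "q = - (of_nat a / of_nat b)" "0 < a"
      using ab by (auto intro: Nat.gr0I)
    then have "q \<in> real_wiener_roots_diam2"
      using negative_rational_is_wiener_root ab by simp
    then show "\<exists>q\<in>real_wiener_roots_diam2. dist q y < e"
      using q by (intro bexI[of _ q]) (auto simp: dist_real_def)
  qed
qed

theorem theorem9:
  shows "dense_in real_wiener_roots {..0} \<and> dense_in real_wiener_roots_diam2 {..0}"
proof -
  \<comment> \<open>Along this inclusion the bound by 0 passes to the smaller set and density to the
    larger one.\<close>
  have "real_wiener_roots_diam2 \<subseteq> real_wiener_roots"
    by (auto simp: real_wiener_roots_diam2_def real_wiener_roots_def)
  then show ?thesis
    using real_wiener_roots_nonpos nonpos_subset_closure closure_mono
    unfolding dense_in_def by blast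
qed

end
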